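(* Let $(V,T,Q,B,S)$ be any feasible solution of the Dynamic Bowser Routing Problem MILP described in the context, that is, any assignment of values to its decision variables satisfying constraints (C1)–(C13). Then for every $a=1,\ldots,A$, every $t=1,\ldots,T$ and every $j=1,\ldots,t$, $$s_a+\sum_{k=1}^{j-1} Q^a_k + \sum_{k=1}^{t} S_k^a - \sum_{k=1}^{t} f^a_k \;\geq\; -M\sum_{n=1}^N \sum_{k=j}^t V^n_{k}\, l^a_{k,n},$$ where $M=\sum_{k=1}^t f^a_k$.
   Context: Dynamic Bowser Routing Problem (DBRP) MILP. A single bowser (fuel truck) refuels $A$ assets over $T$ discrete time periods on a site network with $N$ nodes; node $1$ hosts the fuel cistern. Parameters (all given): positive integers $T,A,N$; $\delta_{i,j}\in\{0,1\}$ for $i,j=1,\ldots,N$ ($\delta_{i,j}=1$ iff one can travel from node $i$ to node $j$ in one period); $l^a_{t,i}\in\{0,1\}$, equal to $1$ iff asset $a$ is at node $i$ during period $t$, so that each asset is at exactly one node in each period ($\sum_{i=1}^N l^a_{t,i}=1$ for all $a,t$); fuel consumption $f^a_t\ge 0$ of asset $a$ in period $t$; tank capacity $c_a>0$ and initial tank level $s_a\ge 0$ of asset $a$; bowser tank capacity $c_b>0$ and initial bowser tank level $s_b\ge 0$. Decision variables: $V^i_t$ (bowser at node $i$ at time $t$), $T^{i,j}_t$ (bowser transits from $i$ to $j$ at the end of period $t$; not to be confused with the number of periods $T$), $Q^a_t$ (fuel delivered to asset $a$ at time $t$), $B_t$ (fuel transferred from the cistern to the bowser at time $t$), $S^a_t$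 (fuel shortage of asset $a$ at time $t$). Constraints (indices range over $t=1,\ldots,T$, $a=1,\ldots,A$, $i,j=1,\ldots,N$, with $t=2,\ldots,T$ in (C5)–(C9)): - (C1) $B_t \leq V^1_t c_b$; - (C2) $s_b + \sum_{k=1}^t B_k - \sum_{k=1}^{t-1} \sum_{a=1}^A Q^a_k \leq c_b$; - (C3) $s_b + \sum_{k=1}^t B_k - \sum_{k=1}^t \sum_{a=1}^A Q^a_k \geq 0$; - (C4) $\sum_{i=1}^N V^i_t = 1$; - (C5) $\delta_{i,j}\geq V^i_{t-1} + V^j_t -1$; - (C6) $\sum_{j=1}^N T_{t-1}^{i,j} = V^i_{t-1}$; - (C7) $T_{t-1}^{i,j}\geq V^i_{t-1}+V^j_{t}-1$; - (C8) $T_{t-1}^{i,j}\leq V^i_{t-1}$; - (C9) $T_{t-1}^{i,j}\leq V^j_{t}$; - (C10) $s_a+\sum_{k=1}^t Q^a_k+\sum_{k=1}^{t-1}S_k^a-\sum_{k=1}^t f^a_k\geq - S_t^a$; - (C11) $s_a+\sum_{k=1}^t Q^a_k+\sum_{k=1}^{t-1}S_k^a-\sum_{k=1}^{t-1} f^a_k\leq c_a$; - (C12) $Q^a_t\leq c_a\sum_{i=1}^N V^i_{t}\,l^a_{t,i}$; - (C13) $T_t^{i,j},V^i_t\in\{0,1\}$, $Q^a_t,B_t\geq 0$, $0\leq S^a_t\leq f^a_t$. *)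

theory Defs
  imports Complex_Main
begin

text \<open>
  All index sets are \<open>{1..n} :: nat set\<close>; parameters and decision variables are total functions
  whose values outside the index ranges are unconstrained. Upper indices come first and the period
  last, except in \<open>l a t i\<close>. The paper's \<open>s\<^sub>a, c\<^sub>a\<close> are \<open>s a, c a\<close> and its \<open>s\<^sub>b, c\<^sub>b\<close> are \<open>sb, cb\<close>,
  where \<open>b\<close> stands for the bowser. Periods are numbered from 1, so \<open>{1..t - 1}\<close> is empty for \<open>t = 1\<close>
  in spite of truncated subtraction.
\<close>

locale dbrp =
  fixes T A N :: nat
    and \<delta> :: "nat \<Rightarrow> nat \<Rightarrow> real"
    and l :: "nat \<Rightarrow> nat \<Rightarrow> nat \<Rightarrow> real"
    and f :: "nat \<Rightarrow> nat \<Rightarrow> real"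
    and c s :: "nat \<Rightarrow> real"
    and cb sb :: real
  assumes T_pos: "T > 0" and A_pos: "A > 0" and N_pos: "N > 0"
    and \<delta>_binary: "\<And>i j. i \<in> {1..N} \<Longrightarrow> j \<in> {1..N} \<Longrightarrow> \<delta> i j \<in> {0, 1}"
    and l_binary:
      "\<And>a t i. a \<in> {1..A} \<Longrightarrow> t \<in> {1..T} \<Longrightarrow> i \<in> {1..N} \<Longrightarrow> l a t i \<in> {0, 1}"
    and l_unique: "\<And>a t. a \<in> {1..A} \<Longrightarrow> t \<in> {1..T} \<Longrightarrow> (\<Sum>i=1..N. l a t i) = 1"
    and f_nonneg: "\<And>a t. a \<in> {1..A} \<Longrightarrow> t \<in> {1..T} \<Longrightarrow> f a t \<ge> 0"
    and c_pos: "\<And>a. a \<in> {1..A} \<Longrightarrow> c a > 0"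
    and s_nonneg: "\<And>a. a \<in> {1..A} \<Longrightarrow> s a \<ge> 0"
    and cb_pos: "cb > 0" and sb_nonneg: "sb \<ge> 0"

text \<open>\<open>X i j t\<close> is the transit variable that the paper writes as \<open>T\<close> with indices \<open>i, j, t\<close>.\<close>

locale dbrp_feasible = dbrp T A N \<delta> l f c s cb sb
  for T A N :: nat
    and \<delta> :: "nat \<Rightarrow> nat \<Rightarrow> real"
    and l :: "nat \<Rightarrow> nat \<Rightarrow> nat \<Rightarrow> real"
    and f :: "nat \<Rightarrow> nat \<Rightarrow> real"
    and c s :: "nat \<Rightarrow> real"
    and cb sb :: real +
  fixes V :: "nat \<Rightarrow> nat \<Rightarrow> real"
    and X :: "nat \<Rightarrow> nat \<Rightarrow> nat \<Rightarrow> real"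
    and Q :: "nat \<Rightarrow> nat \<Rightarrow> real"
    and B :: "nat \<Rightarrow> real"
    and S :: "nat \<Rightarrow> nat \<Rightarrow> real"
  assumes C1: "\<And>t. t \<in> {1..T} \<Longrightarrow> B t \<le> V 1 t * cb"
    and C2: "\<And>t. t \<in> {1..T} \<Longrightarrow>
      sb + (\<Sum>k=1..t. B k) - (\<Sum>k=1..t - 1. \<Sum>a=1..A. Q a k) \<le> cb"
    and C3: "\<And>t. t \<in> {1..T} \<Longrightarrow>
      sb + (\<Sum>k=1..t. B k) - (\<Sum>k=1..t. \<Sum>a=1..A. Q a k) \<ge> 0"
    and C4: "\<And>t. t \<in> {1..T} \<Longrightarrow> (\<Sum>i=1..N. V i t) = 1"
    and C5: "\<And>t i j. t \<in> {2..T} \<Longrightarrow> i \<in> {1..N} \<Longrightarrow> j \<in> {1..N} \<Longrightarrow>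
      \<delta> i j \<ge> V i (t - 1) + V j t - 1"
    and C6: "\<And>t i. t \<in> {2..T} \<Longrightarrow> i \<in> {1..N} \<Longrightarrow> (\<Sum>j=1..N. X i j (t - 1)) = V i (t - 1)"
    and C7: "\<And>t i j. t \<in> {2..T} \<Longrightarrow> i \<in> {1..N} \<Longrightarrow> j \<in> {1..N} \<Longrightarrow>
      X i j (t - 1) \<ge> V i (t - 1) + V j t - 1"
    and C8: "\<And>t i j. t \<in> {2..T} \<Longrightarrow> i \<in> {1..N} \<Longrightarrow> j \<in> {1..N} \<Longrightarrow> X i j (t - 1) \<le> V i (t - 1)"
    and C9: "\<And>t i j. t \<in> {2..T} \<Longrightarrow> i \<in> {1..N} \<Longrightarrow> j \<in> {1..N} \<Longrightarrow> X i j (t - 1) \<le> V j t"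
    and C10: "\<And>a t. a \<in> {1..A} \<Longrightarrow> t \<in> {1..T} \<Longrightarrow>
      s a + (\<Sum>k=1..t. Q a k) + (\<Sum>k=1..t - 1. S a k) - (\<Sum>k=1..t. f a k) \<ge> - S a t"
    and C11: "\<And>a t. a \<in> {1..A} \<Longrightarrow> t \<in> {1..T} \<Longrightarrow>
      s a + (\<Sum>k=1..t. Q a k) + (\<Sum>k=1..t - 1. S a k) - (\<Sum>k=1..t - 1. f a k) \<le> c a"
    and C12: "\<And>a t. a \<in> {1..A} \<Longrightarrow> t \<in> {1..T} \<Longrightarrow>
      Q a t \<le> c a * (\<Sum>i=1..N. V i t * l a t i)"
    and C13_X: "\<And>i j t. i \<in> {1..N} \<Longrightarrow> j \<in> {1..N} \<Longrightarrow> t \<in> {1..T} \<Longrightarrow> X i j t \<in> {0, 1}"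
    and C13_V: "\<And>i t. i \<in> {1..N} \<Longrightarrow> t \<in> {1..T} \<Longrightarrow> V i t \<in> {0, 1}"
    and C13_Q: "\<And>a t. a \<in> {1..A} \<Longrightarrow> t \<in> {1..T} \<Longrightarrow> Q a t \<ge> 0"
    and C13_B: "\<And>t. t \<in> {1..T} \<Longrightarrow> B t \<ge> 0"
    and C13_S: "\<And>a t. a \<in> {1..A} \<Longrightarrow> t \<in> {1..T} \<Longrightarrow> 0 \<le> S a t \<and> S a t \<le> f a t"

end

theory Submission
  imports Defs
begin

text \<open>
  If the bowser meets asset \<open>a\<close> in no period from \<open>j\<close> to \<open>t\<close>, then (C12) forces the deliveries in
  these periods to vanish and the claim is (C10). Otherwise the sum on the right is at least \<open>1\<close>,
  and the claim follows since \<open>s a\<close>, \<open>Q\<close> and \<open>S\<close> are nonnegative.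
\<close>

theorem lemma3:
  fixes T A N :: nat
    and \<delta> :: "nat \<Rightarrow> nat \<Rightarrow> real"
    and l :: "nat \<Rightarrow> nat \<Rightarrow> nat \<Rightarrow> real"
    and f :: "nat \<Rightarrow> nat \<Rightarrow> real"
    and c s :: "nat \<Rightarrow> real"
    and cb sb :: real
    and V :: "nat \<Rightarrow> nat \<Rightarrow> real"
    and X :: "nat \<Rightarrow> nat \<Rightarrow> nat \<Rightarrow> real"
    and Q :: "nat \<Rightarrow> nat \<Rightarrow> real"
    and B :: "nat \<Rightarrow> real"
    and S :: "nat \<Rightarrow> nat \<Rightarrow> real"
    and a t j :: nat
    and M :: real
  assumes "dbrp_feasible T A N \<delta> l f c s cb sb V X Q B S"
    and "a \<in> {1..A}" and "t \<in> {1..T}" and "j \<in> {1..t}"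
    and "M = (\<Sum>k=1..t. f a k)"
  shows "s a + (\<Sum>k=1..j - 1. Q a k) + (\<Sum>k=1..t. S a k) - (\<Sum>k=1..t. f a k)
    \<ge> - M * (\<Sum>n=1..N. \<Sum>k=j..t. V n k * l a k n)"
proof -
  interpret dbrp_feasible T A N \<delta> l f c s cb sb V X Q B S by fact
  \<comment> \<open>\<open>P k\<close> is 1 if the bowser meets asset \<open>a\<close> in period
    \<open>k\<close> and 0 otherwise, as both are at exactly one node.\<close>
  define P where "P k = (\<Sum>n=1..N. V n k * l a k n)" for k
  have swap: "(\<Sum>n=1..N. \<Sum>k=j..t. V n k * l a k n) = (\<Sum>k=j..t. P k)"
    unfolding P_def by (rule sum.swap)
  have range: "k \<in> {1..T}" if "k \<in> {1..t}" for k
    using that assms(3) by auto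
  have meet_binary: "V n k * l a k n \<in> {0, 1}" if "n \<in> {1..N}" "k \<in> {1..t}" for n k
    using C13_V[OF that(1) range[OF that(2)]] l_binary[OF assms(2) range[OF that(2)] that(1)]
    by auto
  have P_nonneg: "P k \<ge> 0" if "k \<in> {1..t}" for k
    unfolding P_def using meet_binary that by (intro sum_nonneg) force
  have jt: "k \<in> {1..t}" if "k \<in> {j..t}" for k
    using that assms(4) by auto
  show ?thesis
  proof (cases "\<forall>k\<in>{j..t}. P k = 0")
    case True
    have "Q a k = 0" if "k \<in> {j..t}" for k
      using C12[OF assms(2) range[OF jt[OF that]]] C13_Q[OF assms(2) range[OF jt[OF that]]]
        True that unfolding P_def by auto
    moreover have "{1..t} = {1..j - 1} \<union> {j..t}" "{1..j - 1} \<inter> {j..t} = {}"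
      using assms(4) by auto
    ultimately have "(\<Sum>k=1..t. Q a k) = (\<Sum>k=1..j - 1. Q a k)"
      by (simp add: sum.union_disjoint)
    \<comment> \<open>(C10) keeps the shortage of period \<open>t\<close> apart, as
      \<open>- S a t\<close> on the right; moving it to the left completes the shortage sum of the
      claim.\<close>
    moreover have "(\<Sum>k=1..t. S a k) = (\<Sum>k=1..t - 1. S a k) + S a t"
      using assms(3) by (cases t) auto
    ultimately show ?thesis
      using C10[OF assms(2,3)] True unfolding swap by simp
  next
    case False
    then obtain k where k: "k \<in> {j..t}" "P k \<noteq> 0" by blast
    then obtain n where n: "n \<in> {1..N}" "V n k * l a k n \<noteq> 0"
      unfolding P_def by (meson sum.neutral)
    \<comment> \<open>Integrality enters here: a nonzero meeting term is a full 1, and as all terms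
      are nonnegative, this one alone bounds the double sum below by 1.\<close>
    have "V n k * l a k n = 1"
      using meet_binary[OF n(1) jt[OF k(1)]] n(2) by blast
    moreover have "V n k * l a k n \<le> P k"
      unfolding P_def using meet_binary jt[OF k(1)] n(1) by (intro member_le_sum) force+
    moreover have "P k \<le> (\<Sum>k=j..t. P k)"
      using P_nonneg jt k(1) by (intro member_le_sum) auto
    ultimately have "1 \<le> (\<Sum>k=j..t. P k)" by linarith
    moreover have "M \<ge> 0"
      unfolding assms(5) using f_nonneg[OF assms(2)] range by (intro sum_nonneg) blast
    \<comment> \<open>\<open>M\<close> is exactly the consumption subtracted on the left, so once
      the right side is at most \<open>- M\<close>, only nonnegativity of the other terms on the
      left remains.\<close>
    ultimately have "M \<le> M * (\<Sum>k=j..t. P k)"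
      using mult_left_mono by fastforce
    moreover have "(\<Sum>k=1..j - 1. Q a k) \<ge> 0" "(\<Sum>k=1..t. S a k) \<ge> 0"
      using assms(3,4) C13_Q[OF assms(2)] C13_S[OF assms(2)] by (auto intro!: sum_nonneg)
    ultimately show ?thesis
      unfolding swap using s_nonneg[OF assms(2)] assms(5) by simp
  qed
qed

end
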